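(* Let $\mathbf X\sim ESN_p(\boldsymbol\mu,\boldsymbol\Sigma,\boldsymbol\lambda,\tau)$. For $\mathbf s=(s_1,\dots,s_p)\in S(p)=\{-1,1\}^p$ let $\boldsymbol\Lambda_s=\mathrm{Diag}(\mathbf s)$, $\boldsymbol\mu_s=\boldsymbol\Lambda_s\boldsymbol\mu$, $\boldsymbol\Sigma_s=\boldsymbol\Lambda_s\boldsymbol\Sigma\boldsymbol\Lambda_s$, $\boldsymbol\lambda_s=\boldsymbol\Lambda_s\boldsymbol\lambda$. Then $\mathbf Z_s=\boldsymbol\Lambda_s\mathbf X\sim ESN_p(\boldsymbol\mu_s,\boldsymbol\Sigma_s,\boldsymbol\lambda_s,\tau)$, and consequently the joint pdf and cdf (for $\mathbf y\ge\mathbf 0$) and the $\boldsymbol\kappa$th raw moment ($\boldsymbol\kappa$ a $p$-vector of nonnegative integers) of $\mathbf Y=|\mathbf X|$ are, respectively, $$f_{\mathbf Y}(\mathbf y)=\sum_{\mathbf s\in S(p)}ESN_p(\mathbf y;\boldsymbol\mu_s,\boldsymbol\Sigma_s,\boldsymbol\lambda_s,\tau),\qquad F_{\mathbf Y}(\mathbf y)=\mathcal L_p(-\mathbf y,\mathbf y;\boldsymbol\mu,\boldsymbol\Sigma,\boldsymbol\lambda,\tau),$$ $$\mathbb E[\mathbf Y^{\boldsymbol\kappa}]=\sum_{\mathbf s\in S(p)}\mathcal I^p_{\boldsymbol\kappa}(\boldsymbol\mu_s,\boldsymbol\Sigma_s,\boldsymbol\lambda_s,\tau).$$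
   Context: Here $\boldsymbol\mu\in\mathbb R^p$, $\boldsymbol\Sigma$ is a $p\times p$ positive definite matrix with symmetric positive definite square root $\boldsymbol\Sigma^{1/2}$ (inverse $\boldsymbol\Sigma^{-1/2}$), $\boldsymbol\lambda\in\mathbb R^p$, $\tau\in\mathbb R$. $\phi_p(\cdot;\boldsymbol\mu,\boldsymbol\Sigma)$ is the $p$-variate normal density and $\Phi_1$ the standard univariate normal cdf. $\mathbf X\sim ESN_p(\boldsymbol\mu,\boldsymbol\Sigma,\boldsymbol\lambda,\tau)$ (extended skew-normal) means that $\mathbf X$ has density $$ESN_p(\mathbf x;\boldsymbol\mu,\boldsymbol\Sigma,\boldsymbol\lambda,\tau)=\xi^{-1}\phi_p(\mathbf x;\boldsymbol\mu,\boldsymbol\Sigma)\,\Phi_1\big(\tau+\boldsymbol\lambda^\top\boldsymbol\Sigma^{-1/2}(\mathbf x-\boldsymbol\mu)\big),\qquad \xi=\Phi_1\big(\tau/(1+\boldsymbol\lambda^\top\boldsymbol\lambda)^{1/2}\big).$$ $|\mathbf X|=(|X_1|,\dots,|X_p|)^\top$; inequalities between vectors are componentwise; $\mathbf y^{\boldsymbol\kappa}=\prod_iy_i^{k_i}$; $\int_{\mathbf a}^{\mathbf b}=\int_{a_1}^{b_1}\cdots\int_{a_p}^{b_p}$. $$\mathcal L_p(\mathbf a,\mathbf b;\boldsymbol\mu,\boldsymbol\Sigma,\boldsymbol\lambda,\tau)=\int_{\mathbf a}^{\mathbf b}ESN_p(\mathbf x;\boldsymbol\mu,\boldsymbol\Sigma,\boldsymbol\lambda,\tau)\,d\mathbf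 x,\qquad \mathcal I^p_{\boldsymbol\kappa}(\boldsymbol\mu,\boldsymbol\Sigma,\boldsymbol\lambda,\tau)=\int_{\mathbf 0}^{\boldsymbol\infty}\mathbf y^{\boldsymbol\kappa}ESN_p(\mathbf y;\boldsymbol\mu,\boldsymbol\Sigma,\boldsymbol\lambda,\tau)\,d\mathbf y.$$ *)

theory Defs
  imports "HOL-Probability.Probability"
begin

subsection \<open>Positive definite matrices and their square root\<close>

definition pos_def_matrix :: "real^'n^'n \<Rightarrow> bool" where
  "pos_def_matrix A \<longleftrightarrow> transpose A = A \<and> (\<forall>x. x \<noteq> 0 \<longrightarrow> 0 < x \<bullet> (A *v x))"

text \<open>A positive definite matrix has exactly one positive definite square root, so the
  description below denotes it whenever \<open>pos_def_matrix A\<close> holds; no value is specified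
  otherwise.\<close>

definition matrix_sqrt :: "real^'n^'n \<Rightarrow> real^'n^'n" where
  "matrix_sqrt A = (THE B. pos_def_matrix B \<and> B ** B = A)"

definition diag_matrix :: "real^'n \<Rightarrow> real^'n^'n" where
  "diag_matrix s = (\<chi> i j. if i = j then s $ i else 0)"

definition sign_vectors :: "(real^'n) set" where
  "sign_vectors = {s. \<forall>i. s $ i \<in> {-1, 1}}"

text \<open>Finiteness guarantees that sums over \<open>sign_vectors\<close> are genuine sums.\<close>

lemma finite_sign_vectors: "finite (sign_vectors :: (real^'n) set)"
proof -
  have "sign_vectors \<subseteq> vec_lambda ` (Pi\<^sub>E (UNIV :: 'n set) (\<lambda>_. {-1, 1 :: real}))"
  proof
    fix s :: "real^'n"
    assume "s \<in> sign_vectors"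
    then have "vec_nth s \<in> Pi\<^sub>E UNIV (\<lambda>_. {-1, 1})"
      by (auto simp: sign_vectors_def)
    then show "s \<in> vec_lambda ` (Pi\<^sub>E UNIV (\<lambda>_. {-1, 1}))"
      by (intro image_eqI[of _ _ "vec_nth s"]) simp_all
  qed
  then show ?thesis
    by (rule finite_subset) (intro finite_imageI finite_PiE, simp_all)
qed

subsection \<open>The extended skew-normal distribution\<close>

definition mvn_density :: "real^'n \<Rightarrow> real^'n^'n \<Rightarrow> real^'n \<Rightarrow> real" where
  "mvn_density \<mu> \<Sigma> x =
     exp (- ((x - \<mu>) \<bullet> (matrix_inv \<Sigma> *v (x - \<mu>))) / 2) / sqrt ((2 * pi) ^ CARD('n) * det \<Sigma>)"

abbreviation std_normal_cdf :: "real \<Rightarrow> real" where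
  "std_normal_cdf \<equiv> cdf std_normal_distribution"

text \<open>The shape vector \<open>l\<close> is the parameter usually written as a lower case lambda.\<close>

definition esn_density ::
    "real^'n \<Rightarrow> real^'n^'n \<Rightarrow> real^'n \<Rightarrow> real \<Rightarrow> real^'n \<Rightarrow> real" where
  "esn_density \<mu> \<Sigma> l \<tau> x =
     inverse (std_normal_cdf (\<tau> / sqrt (1 + l \<bullet> l))) * mvn_density \<mu> \<Sigma> x *
     std_normal_cdf (\<tau> + l \<bullet> (matrix_inv (matrix_sqrt \<Sigma>) *v (x - \<mu>)))"

text \<open>Positive definiteness of the scale matrix is part of what it means to follow the
  distribution.\<close>

definition esn_distributed ::
    "'a measure \<Rightarrow> ('a \<Rightarrow> real^'n) \<Rightarrow> real^'n \<Rightarrow> real^'n^'n \<Rightarrow> real^'n \<Rightarrow> real \<Rightarrow> bool" where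
  "esn_distributed M X \<mu> \<Sigma> l \<tau> \<longleftrightarrow>
     pos_def_matrix \<Sigma> \<and> distributed M lborel X (\<lambda>x. ennreal (esn_density \<mu> \<Sigma> l \<tau> x))"

subsection \<open>Box probabilities and orthant moments\<close>

text \<open>Order and absolute value on \<^typ>\<open>real^'n\<close> are componentwise, so \<open>{a..b}\<close> is
  the box with corners \<open>a\<close> and \<open>b\<close>, and \<open>{0..}\<close> is the nonnegative orthant.\<close>

definition esn_box_integral ::
    "real^'n \<Rightarrow> real^'n \<Rightarrow> real^'n \<Rightarrow> real^'n^'n \<Rightarrow> real^'n \<Rightarrow> real \<Rightarrow> real" where
  "esn_box_integral a b \<mu> \<Sigma> l \<tau> = (LINT x:{a..b}|lborel. esn_density \<mu> \<Sigma> l \<tau> x)"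

definition vec_monom :: "real^'n \<Rightarrow> nat^'n \<Rightarrow> real" where
  "vec_monom y \<kappa> = (\<Prod>i\<in>UNIV. (y $ i) ^ (\<kappa> $ i))"

definition esn_orthant_moment ::
    "nat^'n \<Rightarrow> real^'n \<Rightarrow> real^'n^'n \<Rightarrow> real^'n \<Rightarrow> real \<Rightarrow> real" where
  "esn_orthant_moment \<kappa> \<mu> \<Sigma> l \<tau> =
     (LINT y:{0..}|lborel. vec_monom y \<kappa> * esn_density \<mu> \<Sigma> l \<tau> y)"

end

theory Submission
  imports Defs
begin

text \<open>A sign change \<open>D = diag_matrix s\<close> is a symmetric involution that preserves Lebesgue measure.
Replacing \<open>\<mu>\<close>, \<open>\<Sigma>\<close>, \<open>l\<close> by \<open>D \<mu>\<close>, \<open>D \<Sigma> D\<close>, \<open>D l\<close> therefore turns the density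
\<open>f\<close> into \<open>y \<mapsto> f (D y)\<close> (\<open>esn_density_sign_change\<close>), which is also the density of \<open>D X\<close>
(\<open>distributed_sign_change\<close>). The normal factor only needs \<open>(D \<Sigma> D)\<inverse> = D \<Sigma>\<inverse> D\<close> and an
unchanged determinant. The skewing factor needs \<open>matrix_sqrt (D \<Sigma> D) = D (matrix_sqrt \<Sigma>) D\<close> for the positive definite
square root; conjugation by \<open>D\<close> visibly produces a positive definite root of \<open>D \<Sigma> D\<close>, so this
rests on existence and uniqueness of such roots (\<open>pos_def_square_root_exists\<close>,
\<open>pos_def_square_root_unique\<close>).

Almost every point lies in exactly one open orthant, so an integral over the whole space is the sum
over \<open>s\<close> of integrals over the nonnegative orthant, pulled back along \<open>D\<close>
(\<open>nn_integral_lborel_orthants\<close>). Applied to the event \<open>\<bar>X\<bar> \<in> A\<close>, where \<open>\<bar>D y\<bar> = y\<close> for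
\<open>y \<ge> 0\<close>, this yields the density of \<open>\<bar>X\<bar>\<close> (\<open>distributed_abs\<close>).

The distribution function is the box integral because \<open>\<bar>x\<bar> \<le> y\<close> describes the box from \<open>- y\<close> to
\<open>y\<close>. The moments are obtained by integrating the monomial against the density of \<open>\<bar>X\<bar>\<close> term by
term, which is legitimate because each summand is integrable: an extended skew-normal density is
dominated by a multiple of a spherical Gaussian (\<open>integrable_monom_esn_density\<close>).\<close>

section \<open>Positive definite matrices\<close>

lemma symmetric_matrix_inner:
  fixes A :: "real^'n^'n"
  assumes "transpose A = A"
  shows "x \<bullet> (A *v y) = (A *v x) \<bullet> y"
  using assms by (metis dot_lmul_matrix transpose_matrix_vector)

text \<open>The best constant is the minimum of the quadratic form on the compact unit sphere, and homogeneity
carries it to all vectors.\<close>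

lemma pos_def_matrix_lower_bound:
  fixes A :: "real^'n^'n"
  assumes "pos_def_matrix A"
  obtains m where "0 < m" "\<And>x. m * (norm x)\<^sup>2 \<le> x \<bullet> (A *v x)"
proof -
  have "continuous_on (sphere 0 1) (\<lambda>x. x \<bullet> (A *v x))"
    by (intro continuous_intros)
  \<comment> \<open>any unit vector shows that the sphere is not empty\<close>
  moreover have "axis undefined 1 \<in> (sphere 0 1 :: (real^'n) set)"
    by simp
  ultimately obtain u :: "real^'n" where u: "u \<in> sphere 0 1"
    "\<And>x. x \<in> sphere 0 1 \<Longrightarrow> u \<bullet> (A *v u) \<le> x \<bullet> (A *v x)"
    using continuous_attains_inf[of "sphere (0::real^'n) 1" "\<lambda>x. x \<bullet> (A *v x)"]
    by auto
  show ?thesis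
  proof
    show "0 < u \<bullet> (A *v u)"
      using assms u(1) by (metis norm_eq_zero mem_sphere_0 pos_def_matrix_def zero_neq_one)
    show "(u \<bullet> (A *v u)) * (norm x)\<^sup>2 \<le> x \<bullet> (A *v x)" for x
    proof (cases "x = 0")
      case False
      define y where "y = x /\<^sub>R norm x"
      have "x = norm x *\<^sub>R y"
        using False by (simp add: y_def)
      then have "x \<bullet> (A *v x) = (norm x)\<^sup>2 * (y \<bullet> (A *v y))"
        by (metis (no_types, lifting) inner_scaleR_left inner_scaleR_right mult.assoc
            power2_eq_square scaleR_matrix_vector_assoc matrix_scaleR_vector_ac)
      moreover have "y \<in> sphere 0 1"
        using False by (simp add: y_def)
      ultimately show ?thesis
        using u(2)[of y] by (simp add: mult.commute mult_right_mono)
    qed simp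
  qed
qed

lemma invertible_pos_def_matrix:
  fixes A :: "real^'n^'n"
  assumes "pos_def_matrix A"
  shows "invertible A"
proof -
  have "x = 0" if "A *v x = 0" for x
    using that assms by (metis inner_zero_right less_irrefl pos_def_matrix_def)
  then show ?thesis
    using matrix_left_invertible_ker invertible_left_inverse by blast
qed

lemma matrix_inv_inverse:
  fixes A :: "real^'n^'n"
  assumes "invertible A"
  shows "A ** matrix_inv A = mat 1" "matrix_inv A ** A = mat 1"
  using someI_ex[OF assms[unfolded invertible_def]] by (auto simp: matrix_inv_def)

lemma matrix_inv_eqI:
  fixes A B :: "real^'n^'n"
  assumes "A ** B = mat 1"
  shows "matrix_inv A = B"
proof -
  have "invertible A"
    using assms invertible_right_inverse by blast
  then have "matrix_inv A = matrix_inv A ** (A ** B)"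
    by (simp add: assms)
  also have "\<dots> = B"
    using \<open>invertible A\<close> by (simp add: matrix_mul_assoc matrix_inv_inverse)
  finally show ?thesis .
qed

lemma pos_def_matrix_inv:
  fixes A :: "real^'n^'n"
  assumes "pos_def_matrix A"
  shows "pos_def_matrix (matrix_inv A)"
proof -
  have inv: "invertible A"
    using assms by (rule invertible_pos_def_matrix)
  have sym: "transpose A = A"
    using assms by (simp add: pos_def_matrix_def)
  have "A ** transpose (matrix_inv A) = mat 1"
    by (metis inv matrix_inv_inverse(2) matrix_transpose_mul sym transpose_mat)
  then have "transpose (matrix_inv A) = matrix_inv A"
    using matrix_inv_eqI by metis
  moreover have "0 < x \<bullet> (matrix_inv A *v x)" if "x \<noteq> 0" for x
  proof -
    define y where "y = matrix_inv A *v x"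
    have x: "x = A *v y"
      by (simp add: y_def matrix_vector_mul_assoc matrix_inv_inverse inv)
    then have "y \<noteq> 0"
      using that by auto
    then have "0 < y \<bullet> (A *v y)"
      using assms by (simp add: pos_def_matrix_def)
    also have "\<dots> = x \<bullet> y"
      using x by (simp add: inner_commute)
    finally show ?thesis
      by (simp add: y_def)
  qed
  ultimately show ?thesis
    by (simp add: pos_def_matrix_def)
qed

section \<open>The positive definite square root of a matrix\<close>

text \<open>With \<open>C = A - B\<close>, equality of the squares gives \<open>C A = - B C\<close>. Multiplying by \<open>C\<close> on the right
and taking traces, cyclicity turns this into \<open>tr (C A C) = - tr (C B C)\<close>. Both sides are traces of
positive semidefinite matrices, so both vanish, and definiteness of \<open>A\<close> forces every column of
\<open>C\<close> to be zero.\<close>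

lemma pos_def_square_root_unique:
  fixes A B :: "real^'n^'n"
  assumes A: "pos_def_matrix A" and B: "pos_def_matrix B" and eq: "A ** A = B ** B"
  shows "A = B"
proof -
  define C where "C = A - B"
  have sym: "transpose C = C"
    using A B by (simp add: C_def pos_def_matrix_def transpose_def vec_eq_iff)
  have quad: "trace (C ** P ** C) = (\<Sum>i\<in>UNIV. (C *v axis i 1) \<bullet> (P *v (C *v axis i 1)))"
    for P :: "real^'n^'n"
  proof -
    have "(C ** P ** C) $ i $ i = axis i 1 \<bullet> ((C ** P ** C) *v axis i 1)" for i
      by (simp add: matrix_vector_mul_component inner_axis' matrix_vector_mult_basis column_def)
    also have "\<dots> i = (C *v axis i 1) \<bullet> (P *v (C *v axis i 1))" for i
      by (simp add: symmetric_matrix_inner[OF sym] flip: matrix_vector_mul_assoc)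
    finally show ?thesis
      by (simp add: trace_def)
  qed
  have "C ** A = - (B ** C)"
    using eq by (simp add: C_def matrix_matrix_mult_def vec_eq_iff left_diff_distrib right_diff_distrib sum_subtractf)
  then have "trace (C ** A ** C) = trace (- (B ** C) ** C)"
    by simp
  also have "\<dots> = - trace ((B ** C) ** C)"
    by (simp add: trace_def matrix_matrix_mult_def sum_negf)
  also have "\<dots> = - trace (C ** B ** C)"
    by (metis matrix_mul_assoc trace_mul_sym)
  finally have "(\<Sum>i\<in>UNIV. (C *v axis i 1) \<bullet> (A *v (C *v axis i 1))) +
      (\<Sum>i\<in>UNIV. (C *v axis i 1) \<bullet> (B *v (C *v axis i 1))) = 0"
    by (simp add: quad)
  moreover have nonneg: "0 \<le> x \<bullet> (P *v x)" if "pos_def_matrix P" for P :: "real^'n^'n" and x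
    using that by (cases "x = 0") (auto simp: pos_def_matrix_def less_imp_le)
  ultimately have "(\<Sum>i\<in>UNIV. (C *v axis i 1) \<bullet> (A *v (C *v axis i 1))) = 0"
    by (smt (verit) A B sum_nonneg)
  then have "(C *v axis i 1) \<bullet> (A *v (C *v axis i 1)) = 0" for i
    using nonneg[OF A] by (subst (asm) sum_nonneg_eq_0_iff) auto
  then have "C *v axis i 1 = 0" for i
    using A by (metis less_irrefl pos_def_matrix_def)
  then have "C = 0"
    by (simp add: matrix_vector_mult_basis column_def vec_eq_iff)
  then show ?thesis
    by (simp add: C_def)
qed

text \<open>The equation \<open>F\<^sup>2 + K = 2 F\<close> says \<open>(1 - F)\<^sup>2 = 1 - K\<close>, so \<open>1 - F\<close> is a square root of \<open>1 - K\<close>. The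
map \<open>F \<mapsto> (F\<^sup>2 + K) / 2\<close> sends the symmetric operators of norm at most \<open>norm K\<close> to themselves and
is a contraction there with factor \<open>norm K\<close>, so the Banach fixed point theorem solves the equation.\<close>

lemma symmetric_contraction_fixpoint:
  fixes K :: "'a::euclidean_space \<Rightarrow>\<^sub>L 'a"
  assumes K: "norm K < 1" and sym: "\<And>x y. x \<bullet> K y = K x \<bullet> y"
  obtains F :: "'a \<Rightarrow>\<^sub>L 'a"
  where "norm F < 1" "\<And>x y. x \<bullet> F y = F x \<bullet> y" "(F o\<^sub>L F) + K = 2 *\<^sub>R F"
proof -
  define S where "S = {F :: 'a \<Rightarrow>\<^sub>L 'a. norm F \<le> norm K \<and> (\<forall>x y. x \<bullet> blinfun_apply F y = blinfun_apply F x \<bullet> y)}"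
  define g where "g F = ((F o\<^sub>L F) + K) /\<^sub>R 2" for F
  have "closed S"
    unfolding S_def by (intro closed_Collect_conj closed_Collect_all closed_Collect_le closed_Collect_eq continuous_intros)
  then have "Topological_Spaces.complete S"
    by (simp add: complete_eq_closed)
  moreover have "S \<noteq> {}"
    using sym by (auto simp: S_def)
  moreover have "g F \<in> S" if "F \<in> S" for F
  proof -
    have "norm (F o\<^sub>L F) \<le> norm F * norm F"
      by (rule norm_blinfun_compose)
    also have "\<dots> \<le> norm K * 1"
      using that K by (intro mult_mono) (auto simp: S_def)
    finally have "norm (g F) \<le> norm K"
      using norm_triangle_ineq[of "F o\<^sub>L F" K] by (simp add: g_def)
    moreover have "x \<bullet> g F y = g F x \<bullet> y" for x y
      using that sym by (simp add: g_def S_def blinfun.bilinear_simps inner_simps)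
    ultimately show ?thesis
      by (simp add: S_def)
  qed
  moreover have "dist (g F) (g G) \<le> norm K * dist F G" if "F \<in> S" "G \<in> S" for F G
  proof -
    \<comment> \<open>noncommutative difference of squares: \<open>F\<^sup>2 - G\<^sup>2 = F (F - G) + (F - G) G\<close>\<close>
    have "g F - g G = ((F o\<^sub>L (F - G)) + ((F - G) o\<^sub>L G)) /\<^sub>R 2"
      by (intro blinfun_eqI) (simp add: g_def blinfun.bilinear_simps algebra_simps)
    moreover have "norm (F o\<^sub>L (F - G)) \<le> norm K * norm (F - G)"
      using that by (intro order_trans[OF norm_blinfun_compose] mult_right_mono) (auto simp: S_def)
    moreover have "norm ((F - G) o\<^sub>L G) \<le> norm K * norm (F - G)"
      using that by (intro order_trans[OF norm_blinfun_compose])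
        (auto simp: S_def mult.commute intro!: mult_right_mono)
    ultimately show ?thesis
      using norm_triangle_ineq[of "F o\<^sub>L (F - G)" "(F - G) o\<^sub>L G"] by (simp add: dist_norm)
  qed
  ultimately obtain F where F: "F \<in> S" "g F = F"
    using Banach_fix[of S "norm K" g] K by auto
  then have "2 *\<^sub>R F = 2 *\<^sub>R g F"
    by simp
  then have "(F o\<^sub>L F) + K = 2 *\<^sub>R F"
    by (simp add: g_def)
  with F K show ?thesis
    by (intro that) (auto simp: S_def)
qed

text \<open>For small \<open>t > 0\<close> the operator \<open>K = 1 - t A\<close> has norm below 1. With the fixed point \<open>F\<close> above,
\<open>(1 - F)\<^sup>2 = t A\<close>, so \<open>(1 - F) / sqrt t\<close> is a root of \<open>A\<close>; it is positive definite because
\<open>norm F < 1\<close>.\<close>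

lemma pos_def_square_root_exists:
  fixes A :: "real^'n^'n"
  assumes A: "pos_def_matrix A"
  obtains B where "pos_def_matrix B" "B ** B = A"
proof -
  obtain m where m: "0 < m" "\<And>x. m * (norm x)\<^sup>2 \<le> x \<bullet> (A *v x)"
    using pos_def_matrix_lower_bound[OF A] by blast
  have sym: "transpose A = A"
    using A by (simp add: pos_def_matrix_def)
  obtain L where L: "0 < L" "\<And>x. norm (A *v x) \<le> L * norm x"
    using bounded_linear.pos_bounded[OF matrix_vector_mul_bounded_linear[of A]] by (auto simp: mult.commute)
  \<comment> \<open>minimises \<open>1 - 2 t m + t\<^sup>2 L\<^sup>2\<close>, the bound on the squared norm of \<open>1 - t A\<close>\<close>
  define t where "t = m / L\<^sup>2"
  have t: "0 < t"
    using m(1) L(1) by (simp add: t_def)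
  define K where "K = Blinfun (\<lambda>x. x - t *\<^sub>R (A *v x))"
  have K: "blinfun_apply K x = x - t *\<^sub>R (A *v x)" for x
    unfolding K_def by (subst bounded_linear_Blinfun_apply) (auto intro!: bounded_linear_intros)
  have sq: "(norm (K x))\<^sup>2 \<le> (1 - t * m) * (norm x)\<^sup>2" for x
  proof -
    have "(norm (K x))\<^sup>2 = (norm x)\<^sup>2 - 2 * t * (x \<bullet> (A *v x)) + t\<^sup>2 * (norm (A *v x))\<^sup>2"
      unfolding K power2_norm_eq_inner by (simp add: inner_simps inner_commute power2_eq_square algebra_simps)
    also have "\<dots> \<le> (norm x)\<^sup>2 - 2 * t * (m * (norm x)\<^sup>2) + t\<^sup>2 * (L * norm x)\<^sup>2"
      using t m(2)[of x] L(2)[of x] by (intro add_mono diff_mono mult_left_mono power_mono) auto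
    also have "t\<^sup>2 * (L * norm x)\<^sup>2 = t * m * (norm x)\<^sup>2"
      using L(1) by (simp add: t_def power2_eq_square)
    finally show ?thesis
      by (simp add: algebra_simps)
  qed
  have tm: "0 \<le> 1 - t * m"
    using order_trans[OF zero_le_power2 sq[of "axis undefined 1"]] by simp
  have "norm K \<le> sqrt (1 - t * m)"
  proof (rule norm_blinfun_bound)
    show "norm (K x) \<le> sqrt (1 - t * m) * norm x" for x
      using real_sqrt_le_mono[OF sq[of x]] by (simp add: real_sqrt_mult)
  qed (use tm in simp)
  also have "\<dots> < 1"
    using t m(1) by simp
  finally have "norm K < 1" .
  moreover have "x \<bullet> K y = K x \<bullet> y" for x y
    by (simp add: K inner_simps symmetric_matrix_inner[OF sym])
  ultimately obtain F :: "(real^'n) \<Rightarrow>\<^sub>L (real^'n)"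
    where F: "norm F < 1" "\<And>x y. x \<bullet> F y = F x \<bullet> y" "(F o\<^sub>L F) + K = 2 *\<^sub>R F"
    using symmetric_contraction_fixpoint by blast
  define B where "B = matrix (\<lambda>x. (x - F x) /\<^sub>R sqrt t)"
  have B: "B *v x = (x - F x) /\<^sub>R sqrt t" for x
  proof -
    have "linear (\<lambda>x. (x - F x) /\<^sub>R sqrt t)"
      by (intro bounded_linear.linear bounded_linear_intros)
    then show ?thesis
      by (simp add: B_def matrix_works)
  qed
  show ?thesis
  proof
    have "F (F x) + K x = 2 *\<^sub>R F x" for x
      using arg_cong[OF F(3), of "\<lambda>h. blinfun_apply h x"] by (simp add: blinfun.bilinear_simps)
    then have F_sq: "F (F x) = 2 *\<^sub>R F x - (x - t *\<^sub>R (A *v x))" for x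
      by (simp add: K eq_diff_eq)
    show "B ** B = A"
    proof (subst matrix_eq, rule allI)
      fix x
      have "(B ** B) *v x = (inverse (sqrt t) * inverse (sqrt t)) *\<^sub>R (x - 2 *\<^sub>R F x + F (F x))"
        by (simp add: B blinfun.bilinear_simps scaleR_2 scaleR_right_diff_distrib scaleR_add_right
            flip: matrix_vector_mul_assoc)
      also have "\<dots> = (x - 2 *\<^sub>R F x + F (F x)) /\<^sub>R t"
        using t by (simp flip: inverse_mult_distrib)
      also have "\<dots> = A *v x"
        using t by (simp add: F_sq)
      finally show "(B ** B) *v x = A *v x" .
    qed
    have "x \<bullet> (transpose B *v y) = x \<bullet> (B *v y)" for x y
      by (simp add: B inner_simps F(2) flip: dot_lmul_matrix transpose_matrix_vector)
    then have "transpose B *v y = B *v y" for y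
      by (metis vector_eq_rdot inner_commute)
    then have "transpose B = B"
      by (simp add: matrix_eq)
    moreover have "0 < x \<bullet> (B *v x)" if "x \<noteq> 0" for x
    proof -
      have "x \<bullet> F x \<le> norm x * norm (F x)"
        by (rule norm_cauchy_schwarz)
      also have "\<dots> \<le> norm x * (norm F * norm x)"
        by (intro mult_left_mono norm_blinfun) simp
      also have "\<dots> < norm x * (1 * norm x)"
        using that F(1) by (intro mult_strict_left_mono mult_strict_right_mono) auto
      also have "\<dots> = x \<bullet> x"
        by (simp add: power2_norm_eq_inner flip: power2_eq_square)
      finally show ?thesis
        using t by (simp add: B inner_simps)
    qed
    ultimately show "pos_def_matrix B"
      by (simp add: pos_def_matrix_def)
  qed
qed

lemma matrix_sqrt_eqI:
  fixes A B :: "real^'n^'n"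
  assumes "pos_def_matrix B" "B ** B = A"
  shows "matrix_sqrt A = B"
  unfolding matrix_sqrt_def
  using assms pos_def_square_root_unique by (intro the_equality) auto

text \<open>The determinant is the square of the determinant of the positive definite root.\<close>

lemma pos_def_matrix_det_pos:
  fixes A :: "real^'n^'n"
  assumes "pos_def_matrix A"
  shows "0 < det A"
proof -
  obtain B where B: "B ** B = A"
    using pos_def_square_root_exists[OF assms] .
  then have "det A = (det B)\<^sup>2"
    by (simp add: det_mul power2_eq_square flip: B)
  moreover have "det A \<noteq> 0"
    using assms invertible_det_nz invertible_pos_def_matrix by blast
  ultimately show ?thesis
    by simp
qed

section \<open>Sign changes and the extended skew-normal density\<close>

lemma diag_matrix_mult_vec: "diag_matrix s *v x = (\<chi> i. s $ i * x $ i)"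
  by (simp add: diag_matrix_def matrix_vector_mult_def vec_eq_iff if_distrib[of "\<lambda>c. c * _"] sum.delta cong: if_cong)

lemma sign_vectors_nth:
  assumes "s \<in> sign_vectors"
  shows "s $ i = 1 \<or> s $ i = - 1"
  using assms by (auto simp: sign_vectors_def)

lemma sign_vectors_nth_square [simp]:
  assumes "s \<in> sign_vectors"
  shows "s $ i * s $ i = 1" "s $ i * (s $ i * x) = x"
  using sign_vectors_nth[OF assms, of i] by auto

lemma sign_vectors_nth_abs:
  assumes "s \<in> sign_vectors"
  shows "\<bar>s $ i\<bar> = 1"
  using sign_vectors_nth[OF assms, of i] by auto

lemma diag_sign_involution [simp]:
  assumes "s \<in> sign_vectors"
  shows "diag_matrix s *v (diag_matrix s *v x) = x"
  using assms by (simp add: diag_matrix_mult_vec vec_eq_iff)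

lemma diag_sign_square [simp]:
  assumes "s \<in> sign_vectors"
  shows "diag_matrix s ** diag_matrix s = mat 1" 
  using assms by (simp add: matrix_eq flip: matrix_vector_mul_assoc)

lemma transpose_diag_matrix [simp]: "transpose (diag_matrix s) = diag_matrix s"
  by (auto simp: transpose_def diag_matrix_def vec_eq_iff)

lemma diag_matrix_inner: "x \<bullet> (diag_matrix s *v y) = (diag_matrix s *v x) \<bullet> y"
  by (rule symmetric_matrix_inner) simp

lemma abs_diag_sign:
  assumes "s \<in> sign_vectors"
  shows "\<bar>diag_matrix s *v x\<bar> = \<bar>x\<bar>"
  using assms by (simp add: diag_matrix_mult_vec abs_vec_def vec_eq_iff abs_mult sign_vectors_nth_abs)

context
  fixes s :: "real^'n"
  assumes s: "s \<in> sign_vectors"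
begin

lemma sign_conjugate_mult:
  "(diag_matrix s ** A ** diag_matrix s) ** (diag_matrix s ** B ** diag_matrix s) =
    diag_matrix s ** (A ** B) ** diag_matrix s"
  using s by (simp add: matrix_eq flip: matrix_vector_mul_assoc)

lemma pos_def_matrix_sign_conjugate:
  assumes "pos_def_matrix A"
  shows "pos_def_matrix (diag_matrix s ** A ** diag_matrix s)"
proof -
  have "transpose (diag_matrix s ** A ** diag_matrix s) = diag_matrix s ** A ** diag_matrix s"
    using assms by (simp add: pos_def_matrix_def matrix_transpose_mul matrix_mul_assoc)
  moreover have "0 < x \<bullet> ((diag_matrix s ** A ** diag_matrix s) *v x)" if "x \<noteq> 0" for x
  proof -
    have "diag_matrix s *v x \<noteq> 0"
      using that s by (metis diag_sign_involution matrix_vector_mult_0_right)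
    then show ?thesis
      using assms by (simp add: pos_def_matrix_def diag_matrix_inner flip: matrix_vector_mul_assoc)
  qed
  ultimately show ?thesis
    by (simp add: pos_def_matrix_def)
qed

lemma matrix_inv_sign_conjugate:
  assumes "invertible A"
  shows "matrix_inv (diag_matrix s ** A ** diag_matrix s) = diag_matrix s ** matrix_inv A ** diag_matrix s"
  using assms s by (intro matrix_inv_eqI) (simp add: sign_conjugate_mult matrix_inv_inverse)

lemma matrix_sqrt_sign_conjugate:
  assumes "pos_def_matrix A"
  shows "matrix_sqrt (diag_matrix s ** A ** diag_matrix s) = diag_matrix s ** matrix_sqrt A ** diag_matrix s"
proof -
  obtain B where B: "pos_def_matrix B" "B ** B = A"
    using pos_def_square_root_exists[OF assms] .
  then have "matrix_sqrt A = B"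
    by (rule matrix_sqrt_eqI)
  with B show ?thesis
    by (intro matrix_sqrt_eqI) (simp_all add: pos_def_matrix_sign_conjugate sign_conjugate_mult)
qed

lemma det_sign_conjugate: "det (diag_matrix s ** A ** diag_matrix s) = det A"
proof -
  have "det (diag_matrix s) * det (diag_matrix s) = 1"
    using s by (metis det_I det_mul diag_sign_square)
  then show ?thesis
    by (simp add: det_mul mult.assoc mult.left_commute)
qed

text \<open>Writing \<open>y - D \<mu> = D (D y - \<mu>)\<close>, every sign change in the parameters meets its own inverse inside
an inner product and cancels.\<close>

lemma esn_density_sign_change:
  assumes "pos_def_matrix \<Sigma>"
  shows "esn_density (diag_matrix s *v \<mu>) (diag_matrix s ** \<Sigma> ** diag_matrix s) (diag_matrix s *v l) \<tau> y =
    esn_density \<mu> \<Sigma> l \<tau> (diag_matrix s *v y)"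
proof -
  obtain B where B: "pos_def_matrix B" "B ** B = \<Sigma>"
    using pos_def_square_root_exists[OF assms] .
  then have "invertible (matrix_sqrt \<Sigma>)"
    by (simp add: invertible_pos_def_matrix matrix_sqrt_eqI)
  moreover have "y - diag_matrix s *v \<mu> = diag_matrix s *v (diag_matrix s *v y - \<mu>)"
    using s by (simp add: matrix_vector_mult_diff_distrib)
  moreover have "(diag_matrix s *v u) \<bullet> ((diag_matrix s ** C ** diag_matrix s) *v (diag_matrix s *v v)) = u \<bullet> (C *v v)"
    for u v C
    using s by (simp add: diag_matrix_inner flip: matrix_vector_mul_assoc)
  moreover have "(diag_matrix s *v l) \<bullet> (diag_matrix s *v l) = l \<bullet> l"
    using s by (simp add: diag_matrix_inner)
  ultimately show ?thesis
    using assms by (simp add: esn_density_def mvn_density_def matrix_sqrt_sign_conjugate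
        matrix_inv_sign_conjugate invertible_pos_def_matrix det_sign_conjugate)
qed

section \<open>Sign changes and Lebesgue measure\<close>

lemma borel_measurable_diag_matrix [measurable]: "(\<lambda>x. diag_matrix s *v x) \<in> borel_measurable borel"
  by (intro borel_measurable_continuous_onI continuous_intros)

lemma distr_lborel_sign_change: "distr lborel lborel (\<lambda>x. diag_matrix s *v x) = lborel"
proof -
  \<comment> \<open>the sign change as a scaling by \<open>s \<bullet> j\<close> along each basis vector \<open>j\<close>\<close>
  have T: "(0::real^'n) + (\<Sum>j\<in>Basis. ((s \<bullet> j) * (x \<bullet> j)) *\<^sub>R j) = diag_matrix s *v x" for x
    by (intro euclidean_eqI[of _ "diag_matrix s *v x"])
       (auto simp: diag_matrix_mult_vec inner_sum_left inner_Basis Basis_vec_def inner_axis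
         if_distrib[of "\<lambda>c. _ * c"] sum.delta cong: if_cong)
  have one: "\<bar>s \<bullet> j\<bar> = 1" if "j \<in> Basis" for j
    using that s by (auto simp: Basis_vec_def inner_axis sign_vectors_nth_abs)
  then have "lborel = density (distr lborel borel (\<lambda>x. diag_matrix s *v x)) (\<lambda>_. (\<Prod>j\<in>Basis. \<bar>s \<bullet> j\<bar>))"
    using lborel_affine_euclidean[of "\<lambda>j. s \<bullet> j" 0, unfolded T] by force
  then have "lborel = distr lborel borel (\<lambda>x. diag_matrix s *v x)"
    by (simp add: one density_1)
  then show ?thesis
    by (metis distr_cong sets_lborel)
qed

end

text \<open>A density is transported by pulling it back along the inverse and dividing by the Jacobian; here the
map is its own inverse and preserves the measure.\<close>

lemma distributed_sign_change:
  assumes s: "s \<in> sign_vectors" and X: "distributed M lborel X f"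
  shows "distributed M lborel (\<lambda>\<omega>. diag_matrix s *v X \<omega>) (\<lambda>y. f (diag_matrix s *v y))"
proof -
  let ?T = "\<lambda>x. diag_matrix s *v x"
  note [measurable] = borel_measurable_diag_matrix[OF s]
  have [measurable]: "X \<in> borel_measurable M" "f \<in> borel_measurable borel"
    using X by (auto simp: distributed_def)
  have "distr M lborel (\<lambda>\<omega>. ?T (X \<omega>)) = distr (distr M lborel X) lborel ?T"
    by (simp add: distr_distr comp_def)
  also have "\<dots> = distr (density lborel (\<lambda>y. f (?T (?T y)))) lborel ?T"
    using X s by (simp add: distributed_def)
  also have "\<dots> = density (distr lborel lborel ?T) (\<lambda>y. f (?T y))"
    by (intro density_distr[symmetric]) simp_all
  finally show ?thesis
    using s by (simp add: distributed_def distr_lborel_sign_change)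
qed

section \<open>Folding the space onto the nonnegative orthant\<close>

lemma AE_lborel_nth_nonzero: "AE x in lborel. \<forall>i. (x :: real^'n) $ i \<noteq> 0"
proof -
  have "AE x in lborel. (x :: real^'n) $ i \<noteq> 0" for i
  proof -
    have "negligible {x :: real^'n. x $ i = 0}"
      by (rule negligible_standard_hyperplane_cart)
    moreover have "{x :: real^'n. x $ i = 0} \<in> sets borel"
      by measurable
    ultimately have "{x :: real^'n. x $ i = 0} \<in> null_sets lborel"
      by (simp add: negligible_iff_null_sets null_sets_completion_iff)
    then show ?thesis
      by (auto intro: AE_I'[of "{x :: real^'n. x $ i = 0}"])
  qed
  then show ?thesis
    by (simp add: AE_all_countable)
qed

text \<open>A point without zero coordinates is moved into the nonnegative orthant by exactly one sign change,
namely by its own sign vector. Hence the indicators of the events \<open>D x \<ge> 0\<close> form a partition of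
unity almost everywhere; the coordinate hyperplanes, where several of them overlap, are null sets.
Substituting \<open>x = D y\<close> in each summand moves all pieces to the same orthant.\<close>

lemma nn_integral_lborel_orthants:
  fixes h :: "real^'n \<Rightarrow> ennreal"
  assumes h [measurable]: "h \<in> borel_measurable borel"
  shows "(\<integral>\<^sup>+x. h x \<partial>lborel) =
    (\<Sum>s\<in>sign_vectors. \<integral>\<^sup>+y\<in>{0..}. h (diag_matrix s *v y) \<partial>lborel)"
proof -
  have ind: "(\<Sum>s\<in>sign_vectors. indicator {0..} (diag_matrix s *v x)) = (1 :: ennreal)"
    if x: "\<forall>i. x $ i \<noteq> 0" for x :: "real^'n"
  proof -
    define r :: "real^'n" where "r = (\<chi> i. sgn (x $ i))"
    have r: "r \<in> sign_vectors"
      using x by (auto simp: r_def sign_vectors_def sgn_if)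
    have "diag_matrix s *v x \<in> {0..} \<longleftrightarrow> s = r" if "s \<in> sign_vectors" for s
    proof -
      have "0 \<le> s $ i * x $ i \<longleftrightarrow> s $ i = r $ i" for i
        using sign_vectors_nth[OF that, of i] x[rule_format, of i]
        by (auto simp: r_def sgn_if)
      then show ?thesis
        by (simp add: diag_matrix_mult_vec less_eq_vec_def vec_eq_iff)
    qed
    then have "(\<Sum>s\<in>sign_vectors. indicator {0..} (diag_matrix s *v x)) =
        (\<Sum>s\<in>sign_vectors. if s = r then 1 else 0 :: ennreal)"
      by (intro sum.cong) (auto simp: indicator_def)
    also have "\<dots> = 1"
      by (simp add: r finite_sign_vectors)
    finally show ?thesis .
  qed
  have [measurable]: "{0..} \<in> sets (borel :: (real^'n) measure)"
    by simp
  have "(\<integral>\<^sup>+x. h x \<partial>lborel) =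
      (\<integral>\<^sup>+x. (\<Sum>s\<in>sign_vectors. h x * indicator {0..} (diag_matrix s *v x)) \<partial>lborel)"
    using AE_lborel_nth_nonzero
    by (intro nn_integral_cong_AE) (auto elim!: eventually_mono simp: ind simp flip: sum_distrib_left)
  also have "\<dots> = (\<Sum>s\<in>sign_vectors. \<integral>\<^sup>+x. h x * indicator {0..} (diag_matrix s *v x) \<partial>lborel)"
  proof (rule nn_integral_sum)
    fix s :: "real^'n" assume "s \<in> sign_vectors"
    note [measurable] = borel_measurable_diag_matrix[OF this]
    show "(\<lambda>x. h x * indicator {0..} (diag_matrix s *v x)) \<in> borel_measurable lborel"
      by measurable
  qed
  also have "\<dots> = (\<Sum>s\<in>sign_vectors. \<integral>\<^sup>+y\<in>{0..}. h (diag_matrix s *v y) \<partial>lborel)"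
  proof (rule sum.cong)
    fix s :: "real^'n" assume s: "s \<in> sign_vectors"
    note [measurable] = borel_measurable_diag_matrix[OF s]
    have "(\<integral>\<^sup>+x. h x * indicator {0..} (diag_matrix s *v x) \<partial>lborel) =
      (\<integral>\<^sup>+x. h x * indicator {0..} (diag_matrix s *v x) \<partial>distr lborel lborel ((*v) (diag_matrix s)))"
      by (simp add: distr_lborel_sign_change[OF s])
    also have "\<dots> = (\<integral>\<^sup>+y\<in>{0..}. h (diag_matrix s *v y) \<partial>lborel)"
      using s by (subst nn_integral_distr) simp_all
    finally show "(\<integral>\<^sup>+x. h x * indicator {0..} (diag_matrix s *v x) \<partial>lborel) =
      (\<integral>\<^sup>+y\<in>{0..}. h (diag_matrix s *v y) \<partial>lborel)" .
  qed simp
  finally show ?thesis .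
qed

text \<open>The event \<open>\<bar>X\<bar> \<in> A\<close> has probability \<open>\<integral> f x * indicator A \<bar>x\<bar>\<close>. On the piece belonging to \<open>s\<close> the
absolute value of \<open>D y\<close> is \<open>y\<close> itself, so only the density remembers the sign.\<close>

lemma distributed_abs:
  fixes X :: "'a \<Rightarrow> real^'n" and f :: "real^'n \<Rightarrow> ennreal"
  assumes X: "distributed M lborel X f"
  shows "distributed M lborel (\<lambda>\<omega>. \<bar>X \<omega>\<bar>)
    (\<lambda>y. if 0 \<le> y then \<Sum>s\<in>sign_vectors. f (diag_matrix s *v y) else 0)" (is "distributed _ _ _ ?g")
proof -
  have [measurable]: "X \<in> borel_measurable M" "f \<in> borel_measurable borel"
    using X by (auto simp: distributed_def)
  have [measurable]: "(\<lambda>x. \<bar>x\<bar>) \<in> borel_measurable (borel :: (real^'n) measure)"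
    unfolding abs_vec_def by (intro borel_measurable_continuous_onI continuous_intros)
  have [measurable]: "{0..} \<in> sets (borel :: (real^'n) measure)"
    by simp
  have g: "?g = (\<lambda>y. \<Sum>s\<in>sign_vectors. f (diag_matrix s *v y) * indicator {0..} y)"
    by (auto simp: fun_eq_iff)
  have meas: "(\<lambda>y. f (diag_matrix s *v y)) \<in> borel_measurable borel" if "s \<in> sign_vectors" for s
    using borel_measurable_diag_matrix[OF that] by measurable
  have [measurable]: "?g \<in> borel_measurable borel"
    unfolding g using meas by (intro borel_measurable_sum borel_measurable_times_ennreal) auto
  have "distr M lborel (\<lambda>\<omega>. \<bar>X \<omega>\<bar>) = density lborel ?g"
  proof (rule measure_eqI)
    fix A assume "A \<in> sets (distr M lborel (\<lambda>\<omega>. \<bar>X \<omega>\<bar>))"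
    then have [measurable]: "A \<in> sets borel"
      by simp
    have "emeasure (distr M lborel (\<lambda>\<omega>. \<bar>X \<omega>\<bar>)) A = (\<integral>\<^sup>+\<omega>. indicator A \<bar>X \<omega>\<bar> \<partial>M)"
      by (simp add: nn_integral_distr flip: nn_integral_indicator)
    also have "\<dots> = (\<integral>\<^sup>+x. f x * indicator A \<bar>x\<bar> \<partial>lborel)"
      using distributed_nn_integral[OF X, of "\<lambda>x. indicator A \<bar>x\<bar>"] by simp
    also have "\<dots> = (\<Sum>s\<in>sign_vectors. \<integral>\<^sup>+y\<in>{0..}. f (diag_matrix s *v y) * indicator A \<bar>diag_matrix s *v y\<bar> \<partial>lborel)"
      by (rule nn_integral_lborel_orthants) measurable
    also have "\<dots> = (\<Sum>s\<in>sign_vectors. \<integral>\<^sup>+y. f (diag_matrix s *v y) * indicator {0..} y * indicator A y \<partial>lborel)"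
      by (intro sum.cong nn_integral_cong) (auto simp: abs_diag_sign indicator_def)
    also have "\<dots> = (\<integral>\<^sup>+y. ?g y * indicator A y \<partial>lborel)"
    proof -
      have "?g y * indicator A y =
          (\<Sum>s\<in>sign_vectors. f (diag_matrix s *v y) * indicator {0..} y * indicator A y)" for y
        by (simp add: indicator_def)
      then show ?thesis
        using meas by (simp add: nn_integral_sum)
    qed
    also have "\<dots> = emeasure (density lborel ?g) A"
      by (simp add: emeasure_density)
    finally show "emeasure (distr M lborel (\<lambda>\<omega>. \<bar>X \<omega>\<bar>)) A = emeasure (density lborel ?g) A" .
  qed simp
  then show ?thesis
    by (simp add: distributed_def)
qed

section \<open>Integrability of monomials against the density\<close>

lemma borel_measurable_std_normal_cdf [measurable]: "std_normal_cdf \<in> borel_measurable borel"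
proof -
  interpret real_distribution std_normal_distribution
    by (rule real_dist_normal_dist)
  show ?thesis
    by (intro borel_measurable_mono) (simp add: mono_def cdf_nondecreasing)
qed

lemma std_normal_cdf_bounds: "0 \<le> std_normal_cdf x" "std_normal_cdf x \<le> 1"
proof -
  interpret real_distribution std_normal_distribution
    by (rule real_dist_normal_dist)
  show "0 \<le> std_normal_cdf x" "std_normal_cdf x \<le> 1"
    by (simp_all add: cdf_nonneg cdf_bounded_prob)
qed

lemma borel_measurable_esn_density [measurable]:
  fixes \<mu> :: "real^'n"
  shows "esn_density \<mu> \<Sigma> l \<tau> \<in> borel_measurable borel"
proof -
  have [measurable]: "(\<lambda>x. A *v x) \<in> borel_measurable borel" for A :: "real^'n^'n"
    by (intro borel_measurable_continuous_onI continuous_intros)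
  show ?thesis
    unfolding esn_density_def mvn_density_def by measurable
qed

lemma esn_density_nonneg:
  assumes "pos_def_matrix \<Sigma>"
  shows "0 \<le> esn_density \<mu> \<Sigma> l \<tau> x"
  using pos_def_matrix_det_pos[OF assms]
  by (simp add: esn_density_def mvn_density_def std_normal_cdf_bounds)

text \<open>Up to a constant this is an absolute moment of the centred normal distribution with variance
\<open>1 / (2 c)\<close>.\<close>

lemma integrable_power_gaussian:
  fixes c :: real
  assumes c: "0 < c"
  shows "integrable lborel (\<lambda>x. \<bar>x\<bar> ^ k * exp (- c * x\<^sup>2))"
proof -
  define \<sigma> where "\<sigma> = 1 / sqrt (2 * c)"
  have \<sigma>: "0 < \<sigma>" "2 * \<sigma>\<^sup>2 = 1 / c"
    using c by (simp_all add: \<sigma>_def power_divide)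
  have "integrable lborel (\<lambda>x. sqrt (2 * pi * \<sigma>\<^sup>2) * (normal_density 0 \<sigma> x * \<bar>x - 0\<bar> ^ k))"
    using \<sigma> by (intro integrable_mult_right integrable_normal_moment_abs)
  also have "(\<lambda>x. sqrt (2 * pi * \<sigma>\<^sup>2) * (normal_density 0 \<sigma> x * \<bar>x - 0\<bar> ^ k)) =
      (\<lambda>x. \<bar>x\<bar> ^ k * exp (- c * x\<^sup>2))"
    using \<sigma> by (simp add: fun_eq_iff normal_density_def mult.commute)
  finally show ?thesis .
qed

text \<open>The integrand is a product of functions of one coordinate each, so Tonelli reduces the claim to the
one-dimensional case.\<close>

lemma integrable_monom_gaussian:
  fixes c :: real and \<kappa> :: "nat^'n"
  assumes c: "0 < c"
  shows "integrable lborel (\<lambda>x. vec_monom \<bar>x\<bar> \<kappa> * exp (- c * (norm x)\<^sup>2))"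
proof -
  \<comment> \<open>the product formula for integrals is indexed by basis vectors, so exponents are read off from them\<close>
  define f where "f b t = \<bar>t\<bar> ^ (\<kappa> $ (THE i. b = axis i (1::real))) * exp (- c * t\<^sup>2)"
    for b :: "real^'n" and t
  have bas: "(\<Prod>b\<in>Basis. g b) = (\<Prod>i\<in>UNIV. g (axis i 1))" for g :: "real^'n \<Rightarrow> real"
    by (rule prod.reindex_cong[of "\<lambda>i. axis i 1"]) (auto simp: inj_on_def axis_eq_axis Basis_vec_def)
  have eq: "vec_monom \<bar>x\<bar> \<kappa> * exp (- c * (norm x)\<^sup>2) = (\<Prod>b\<in>Basis. f b (x \<bullet> b))" for x :: "real^'n"
  proof -
    have "(norm x)\<^sup>2 = (\<Sum>i\<in>UNIV. (x $ i)\<^sup>2)"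
      unfolding power2_norm_eq_inner inner_vec_def by (simp add: power2_eq_square)
    then have "exp (- c * (norm x)\<^sup>2) = (\<Prod>i\<in>UNIV. exp (- c * (x $ i)\<^sup>2))"
      by (simp add: sum_distrib_left exp_sum flip: sum_negf)
    then show ?thesis
      by (simp add: bas f_def vec_monom_def abs_vec_def prod.distrib inner_axis axis_eq_axis)
  qed
  have int: "integrable lborel (f b)" for b
    unfolding f_def using c by (rule integrable_power_gaussian)
  then have [measurable]: "f b \<in> borel_measurable borel" for b
    by (simp add: borel_measurable_integrable)
  have nonneg: "0 \<le> f b t" for b t
    by (simp add: f_def)
  have "(\<integral>\<^sup>+x. ennreal (\<Prod>b\<in>Basis. f b (x \<bullet> b)) \<partial>lborel) = (\<Prod>b\<in>Basis. \<integral>\<^sup>+t. ennreal (f b t) \<partial>lborel)"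
    using nn_integral_lborel_prod[where f = "\<lambda>b t. ennreal (f b t)"]
    by (simp add: nonneg flip: prod_ennreal)
  also have "\<dots> < \<infinity>"
    using int by (simp add: nn_integral_eq_integral nonneg prod_ennreal integral_nonneg)
  finally show ?thesis
    unfolding eq by (intro integrableI_nonneg) (auto simp: nonneg prod_nonneg)
qed

text \<open>The skewing factor is at most 1, and the quadratic form in the exponent is at least
\<open>m * (norm (x - \<mu>))\<^sup>2\<close>. Since \<open>(norm (x - \<mu>))\<^sup>2 \<ge> (norm x)\<^sup>2 / 2 - (norm \<mu>)\<^sup>2\<close>, the location
contributes only a constant factor, and a Gaussian centred at the origin dominates the density.\<close>

lemma integrable_monom_esn_density:
  fixes \<kappa> :: "nat^'n"
  assumes \<Sigma>: "pos_def_matrix \<Sigma>"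
  shows "integrable lborel (\<lambda>x. vec_monom \<bar>x\<bar> \<kappa> * esn_density \<mu> \<Sigma> l \<tau> x)"
proof -
  obtain m where m: "0 < m" "\<And>x. m * (norm x)\<^sup>2 \<le> x \<bullet> (matrix_inv \<Sigma> *v x)"
    using pos_def_matrix_lower_bound[OF pos_def_matrix_inv[OF \<Sigma>]] by blast
  define C where "C = inverse (std_normal_cdf (\<tau> / sqrt (1 + l \<bullet> l))) *
    (exp (m * (norm \<mu>)\<^sup>2 / 2) / sqrt ((2 * pi) ^ CARD('n) * det \<Sigma>))"
  have monom: "0 \<le> vec_monom \<bar>x\<bar> \<kappa>" for x :: "real^'n"
    by (simp add: vec_monom_def prod_nonneg abs_vec_def)
  have bound: "esn_density \<mu> \<Sigma> l \<tau> x \<le> C * exp (- (m / 4) * (norm x)\<^sup>2)" for x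
  proof -
    have "norm x \<le> norm (x - \<mu>) + norm \<mu>"
      using norm_triangle_ineq[of "x - \<mu>" \<mu>] by simp
    then have "(norm x)\<^sup>2 \<le> (norm (x - \<mu>) + norm \<mu>)\<^sup>2"
      by (simp add: power_mono)
    also have "\<dots> \<le> 2 * (norm (x - \<mu>))\<^sup>2 + 2 * (norm \<mu>)\<^sup>2"
      using sum_squares_bound[of "norm (x - \<mu>)" "norm \<mu>"] by (simp add: power2_sum)
    finally have "m * (norm x)\<^sup>2 \<le> m * (2 * (norm (x - \<mu>))\<^sup>2 + 2 * (norm \<mu>)\<^sup>2)"
      using m(1) by simp
    then have "m * (norm x)\<^sup>2 \<le> 2 * (m * (norm (x - \<mu>))\<^sup>2) + 2 * (m * (norm \<mu>)\<^sup>2)"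
      by (simp add: algebra_simps)
    then have "exp (- ((x - \<mu>) \<bullet> (matrix_inv \<Sigma> *v (x - \<mu>))) / 2) \<le>
        exp (m * (norm \<mu>)\<^sup>2 / 2 + - (m / 4) * (norm x)\<^sup>2)"
      unfolding exp_le_cancel_iff using m(2)[of "x - \<mu>"] by linarith
    then have mvn: "mvn_density \<mu> \<Sigma> x \<le>
        exp (m * (norm \<mu>)\<^sup>2 / 2) / sqrt ((2 * pi) ^ CARD('n) * det \<Sigma>) * exp (- (m / 4) * (norm x)\<^sup>2)"
      using pos_def_matrix_det_pos[OF \<Sigma>]
      unfolding mvn_density_def exp_add by (simp add: divide_right_mono mult.commute)
    have "esn_density \<mu> \<Sigma> l \<tau> x \<le> inverse (std_normal_cdf (\<tau> / sqrt (1 + l \<bullet> l))) * mvn_density \<mu> \<Sigma> x * 1"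
      unfolding esn_density_def using pos_def_matrix_det_pos[OF \<Sigma>]
      by (intro mult_left_mono std_normal_cdf_bounds mult_nonneg_nonneg)
         (simp_all add: std_normal_cdf_bounds mvn_density_def)
    also have "\<dots> \<le> C * exp (- (m / 4) * (norm x)\<^sup>2)"
      unfolding C_def mult.assoc mult_1_right using mvn
      by (intro mult_left_mono) (simp_all add: std_normal_cdf_bounds mult.assoc)
    finally show ?thesis .
  qed
  have "integrable lborel (\<lambda>x. C * (vec_monom \<bar>x\<bar> \<kappa> * exp (- (m / 4) * (norm x)\<^sup>2)))"
    using m(1) by (intro integrable_mult_right integrable_monom_gaussian) simp
  then show ?thesis
  proof (rule Bochner_Integration.integrable_bound)
    have [measurable]: "(\<lambda>x :: real^'n. vec_monom \<bar>x\<bar> \<kappa>) \<in> borel_measurable borel"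
      unfolding vec_monom_def abs_vec_def vec_lambda_beta by measurable
    show "(\<lambda>x. vec_monom \<bar>x\<bar> \<kappa> * esn_density \<mu> \<Sigma> l \<tau> x) \<in> borel_measurable lborel"
      by measurable
    show "AE x in lborel. norm (vec_monom \<bar>x\<bar> \<kappa> * esn_density \<mu> \<Sigma> l \<tau> x)
        \<le> norm (C * (vec_monom \<bar>x\<bar> \<kappa> * exp (- (m / 4) * (norm x)\<^sup>2)))"
    proof (rule AE_I2)
      fix x
      have "vec_monom \<bar>x\<bar> \<kappa> * esn_density \<mu> \<Sigma> l \<tau> x \<le> C * (vec_monom \<bar>x\<bar> \<kappa> * exp (- (m / 4) * (norm x)\<^sup>2))"
        using mult_left_mono[OF bound monom] by (simp add: mult_ac)
      then show "norm (vec_monom \<bar>x\<bar> \<kappa> * esn_density \<mu> \<Sigma> l \<tau> x)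
        \<le> norm (C * (vec_monom \<bar>x\<bar> \<kappa> * exp (- (m / 4) * (norm x)\<^sup>2)))"
        using monom[of x] esn_density_nonneg[OF \<Sigma>, of \<mu> l \<tau> x] by (simp add: abs_of_nonneg)
    qed
  qed
qed

section \<open>The distribution of the componentwise absolute value\<close>

theorem proposition6:
  fixes M :: "'a measure" and X :: "'a \<Rightarrow> real^'n"
    and \<mu> l :: "real^'n" and \<Sigma> :: "real^'n^'n" and \<tau> :: real
    and \<mu>s ls :: "real^'n \<Rightarrow> real^'n" and \<Sigma>s :: "real^'n \<Rightarrow> real^'n^'n"
  defines "\<mu>s \<equiv> \<lambda>s. diag_matrix s *v \<mu>"
    and "\<Sigma>s \<equiv> \<lambda>s. diag_matrix s ** \<Sigma> ** diag_matrix s"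
    and "ls \<equiv> \<lambda>s. diag_matrix s *v l"
  assumes "prob_space M" and "esn_distributed M X \<mu> \<Sigma> l \<tau>"
  shows "(\<forall>s\<in>sign_vectors.
            esn_distributed M (\<lambda>\<omega>. diag_matrix s *v X \<omega>) (\<mu>s s) (\<Sigma>s s) (ls s) \<tau>) \<and>
         distributed M lborel (\<lambda>\<omega>. \<bar>X \<omega>\<bar>)
           (\<lambda>y. ennreal (if 0 \<le> y
                 then \<Sum>s\<in>sign_vectors. esn_density (\<mu>s s) (\<Sigma>s s) (ls s) \<tau> y else 0)) \<and>
         (\<forall>y\<ge>0. \<P>(\<omega> in M. \<bar>X \<omega>\<bar> \<le> y) = esn_box_integral (- y) y \<mu> \<Sigma> l \<tau>) \<and>
         (\<forall>\<kappa> :: nat^'n.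
            integrable M (\<lambda>\<omega>. vec_monom \<bar>X \<omega>\<bar> \<kappa>) \<and>
            prob_space.expectation M (\<lambda>\<omega>. vec_monom \<bar>X \<omega>\<bar> \<kappa>) =
              (\<Sum>s\<in>sign_vectors. esn_orthant_moment \<kappa> (\<mu>s s) (\<Sigma>s s) (ls s) \<tau>))"
proof -
  interpret prob_space M
    by fact
  let ?f = "esn_density \<mu> \<Sigma> l \<tau>"
  let ?fs = "\<lambda>s. esn_density (\<mu>s s) (\<Sigma>s s) (ls s) \<tau>"
  have \<Sigma>: "pos_def_matrix \<Sigma>" and X: "distributed M lborel X (\<lambda>x. ennreal (?f x))"
    using assms(5) by (auto simp: esn_distributed_def)
  have [measurable]: "X \<in> borel_measurable M"
    using X by (simp add: distributed_def)
  have fs: "?fs s y = ?f (diag_matrix s *v y)" if "s \<in> sign_vectors" for s y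
    unfolding \<mu>s_def \<Sigma>s_def ls_def using that \<Sigma> by (rule esn_density_sign_change)
  have \<Sigma>s: "pos_def_matrix (\<Sigma>s s)" if "s \<in> sign_vectors" for s
    unfolding \<Sigma>s_def using that \<Sigma> by (rule pos_def_matrix_sign_conjugate)
  have fs_nonneg: "0 \<le> ?fs s y" if "s \<in> sign_vectors" for s y
    using \<Sigma>s[OF that] by (rule esn_density_nonneg)

  have Z: "esn_distributed M (\<lambda>\<omega>. diag_matrix s *v X \<omega>) (\<mu>s s) (\<Sigma>s s) (ls s) \<tau>"
    if s: "s \<in> sign_vectors" for s
    using distributed_sign_change[OF s X] \<Sigma>s[OF s] by (simp add: esn_distributed_def fs[OF s])

  define g where "g y = (if 0 \<le> y then \<Sum>s\<in>sign_vectors. ?fs s y else 0)" for y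
  have "ennreal (g y) = (if 0 \<le> y then \<Sum>s\<in>sign_vectors. ennreal (?f (diag_matrix s *v y)) else 0)" for y
    using fs_nonneg by (simp add: g_def fs flip: sum_ennreal)
  with distributed_abs[OF X] have Y: "distributed M lborel (\<lambda>\<omega>. \<bar>X \<omega>\<bar>) (\<lambda>y. ennreal (g y))"
    by simp

  have cdf: "\<P>(\<omega> in M. \<bar>X \<omega>\<bar> \<le> y) = esn_box_integral (- y) y \<mu> \<Sigma> l \<tau>" for y
  proof -
    have box: "\<bar>x\<bar> \<le> y \<longleftrightarrow> x \<in> {- y..y}" for x :: "real^'n"
      by (auto simp: less_eq_vec_def abs_vec_def abs_le_iff minus_le_iff)
    have "\<P>(\<omega> in M. \<bar>X \<omega>\<bar> \<le> y) = (\<integral>\<omega>. indicator {- y..y} (X \<omega>) \<partial>M)"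
      by (subst Bochner_Integration.integral_cong[OF refl,
            of _ _ "indicator {\<omega> \<in> space M. \<bar>X \<omega>\<bar> \<le> y}"]) (auto simp: box indicator_def)
    also have "\<dots> = (\<integral>x. ?f x * indicator {- y..y} x \<partial>lborel)"
      using distributed_integral[OF X, of "indicator {- y..y}"] by (simp add: esn_density_nonneg[OF \<Sigma>])
    finally show ?thesis
      by (simp add: esn_box_integral_def set_lebesgue_integral_def mult.commute)
  qed

  have moments: "integrable M (\<lambda>\<omega>. vec_monom \<bar>X \<omega>\<bar> \<kappa>) \<and>
      expectation (\<lambda>\<omega>. vec_monom \<bar>X \<omega>\<bar> \<kappa>) = (\<Sum>s\<in>sign_vectors. esn_orthant_moment \<kappa> (\<mu>s s) (\<Sigma>s s) (ls s) \<tau>)"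
    for \<kappa> :: "nat^'n"
  proof -
    have [measurable]: "(\<lambda>y. vec_monom y \<kappa>) \<in> borel_measurable borel"
      unfolding vec_monom_def by measurable
    have g_nonneg: "0 \<le> g y" for y
      using fs_nonneg by (simp add: g_def sum_nonneg)
    have abs: "y \<in> {0..} \<Longrightarrow> \<bar>y\<bar> = y" for y :: "real^'n"
      by (simp add: less_eq_vec_def abs_vec_def vec_eq_iff)
    have int: "integrable lborel (\<lambda>y. indicator {0..} y *\<^sub>R (vec_monom y \<kappa> * ?fs s y))"
      if "s \<in> sign_vectors" for s
    proof -
      have "integrable lborel (\<lambda>y. indicator {0..} y *\<^sub>R (vec_monom \<bar>y\<bar> \<kappa> * ?fs s y))"
        using integrable_monom_esn_density[OF \<Sigma>s[OF that]] by (intro integrable_mult_indicator) auto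
      also have "(\<lambda>y. indicator {0..} y *\<^sub>R (vec_monom \<bar>y\<bar> \<kappa> * ?fs s y)) = (\<lambda>y. indicator {0..} y *\<^sub>R (vec_monom y \<kappa> * ?fs s y))"
        using abs by (auto simp: fun_eq_iff indicator_def)
      finally show ?thesis .
    qed
    have split: "g y * vec_monom y \<kappa> =
        (\<Sum>s\<in>sign_vectors. indicator {0..} y *\<^sub>R (vec_monom y \<kappa> * ?fs s y))" for y
      by (simp add: g_def sum_distrib_left mult.commute)
    have "integrable lborel (\<lambda>y. g y * vec_monom y \<kappa>)"
      unfolding split using int by (rule Bochner_Integration.integrable_sum)
    moreover have "(\<integral>y. g y * vec_monom y \<kappa> \<partial>lborel) =
        (\<Sum>s\<in>sign_vectors. esn_orthant_moment \<kappa> (\<mu>s s) (\<Sigma>s s) (ls s) \<tau>)"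
      unfolding split esn_orthant_moment_def set_lebesgue_integral_def
      using int by (rule Bochner_Integration.integral_sum)
    ultimately show ?thesis
      using distributed_integrable[OF Y, of "\<lambda>y. vec_monom y \<kappa>"]
        distributed_integral[OF Y, of "\<lambda>y. vec_monom y \<kappa>"] by (simp add: g_nonneg)
  qed

  show ?thesis
    using Z Y cdf moments by (simp add: g_def)
qed

end
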